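(* Assume: (i) for all $x,u\in\mathbb R$, the processes $b(\cdot,x,u)$ and $\sigma(\cdot,x,u)$ are adapted and belong to $L^{2a}_{\mathcal F}(0,N-1)$; (ii) $b(n,x,u),\sigma(n,x,u)$ are differentiable with respect to $(x,u)$ and there is $L>0$ such that $|\phi(n,x_1,u_1)-\phi(n,x_2,u_2)|\le L(|x_1-x_2|+|u_1-u_2|)$ for all $n\in\{0,\dots,N-1\}$, $x_1,x_2,u_1,u_2\in\mathbb R$ and $\phi=b,\sigma,b_x,\sigma_x,b_u,\sigma_u$; (iii) $l(n,x,u),\Phi(x)$ are differentiable with respect to $(x,u)$ and $|l_x(n,x,u)|+|\Phi_x(x)|\le L(1+|x|+|u|)$ for all $n\in\{0,\dots,N-1\}$, $x,u\in\mathbb R$; (iv) $b(N,x,u)=\sigma(N,x,u)=l(N,x,u)=0$ for all $(x,u)$. Let $u\in\mathbb U$. Then the stochastic difference equation $$X_{n+1}=X_n+b(n,X_n,u_n)+\sigma(n,X_n,u_n)\xi^H_n,\quad 0\le n\le N-1,\qquad X_0=x,$$ has a unique solution $X\in L^2_{\mathcal F}(0,N)$.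
   Context: Fix $H\in(0,1)$, $a>1$, $N\ge1$. All processes are scalar. $B^H$ is a fractional Brownian motion with Hurst parameter $H$ (continuous centered Gaussian, $\mathbb E[B^H(t)B^H(s)]=\frac12(t^{2H}+s^{2H}-|t-s|^{2H})$) on $(\Omega,\mathcal F,P)$; $\xi^H_n=B^H(n+1)-B^H(n)$, $n\ge0$; $\mathcal F_0\subset\mathcal F$ is a sub-$\sigma$-algebra and $\mathcal F_n=\mathcal F_0\vee\sigma(\xi^H_0,\dots,\xi^H_{n-1})$. $L^\beta(\mathcal F_n)$ is the set of $\mathcal F_n$-measurable random variables with finite $\beta$-th absolute moment; $L^\beta_{\mathcal F}(n_1,n_2)$ is the set of processes $(X_n)_{n_1\le n\le n_2}$, $X_n$ being $\mathcal F_n$-measurable, with $\sum_{n=n_1}^{n_2}\mathbb E|X_n|^\beta<\infty$. The initial value $x\in L^{2a}(\mathcal F_0)$ is independent of $(\xi^H_n)$. The functions $b,\sigma$ (state coefficients, possibly random and adapted) and $l$ (running cost) are real-valued measurable functions of $(n,x,u)\in\{0,\dots,N-1\}\times\mathbb R\times\mathbb R$ (extended to $n=N$ by (iv)), and $\Phi:\mathbb R\to\mathbb R$ (terminal cost) is measurable; subscripts $x,u$ denote partial derivatives. $\mathbb U$ is the set of progressively measurable (i.e. adapted) processes $u=(u_n)_{0\le n\le N-1}$ with values in a given closed convex set $\mathbf U\subset\mathbb R$ and $\mathbb E\sum_{n=0}^{N-1}|u_n|^{2a}<\infty$. *)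

theory Defs
  imports "HOL-Probability.Probability"
begin

text \<open>Normal law with mean zero; the variance may be zero, in which case the law is the
  point mass at zero.\<close>

definition centered_gaussian :: "'a measure \<Rightarrow> ('a \<Rightarrow> real) \<Rightarrow> bool" where
  "centered_gaussian M Y \<longleftrightarrow> Y \<in> borel_measurable M \<and>
     ((AE \<omega> in M. Y \<omega> = 0) \<or> (\<exists>s>0. distributed M lborel Y (normal_density 0 s)))"

definition centered_gaussian_process :: "'a measure \<Rightarrow> (real \<Rightarrow> 'a \<Rightarrow> real) \<Rightarrow> bool" where
  "centered_gaussian_process M B \<longleftrightarrow>
     (\<forall>T c. finite T \<and> T \<subseteq> {0..} \<longrightarrow> centered_gaussian M (\<lambda>\<omega>. \<Sum>t\<in>T. c t * B t \<omega>))"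

text \<open>The time index set is the half-line of nonnegative reals; values of \<open>B\<close> at negative times
  are irrelevant.\<close>

definition fractional_brownian_motion ::
    "'a measure \<Rightarrow> real \<Rightarrow> (real \<Rightarrow> 'a \<Rightarrow> real) \<Rightarrow> bool" where
  "fractional_brownian_motion M H B \<longleftrightarrow>
     centered_gaussian_process M B \<and>
     (AE \<omega> in M. continuous_on {0..} (\<lambda>t. B t \<omega>)) \<and>
     (\<forall>t\<ge>0. \<forall>s\<ge>0. integral\<^sup>L M (\<lambda>\<omega>. B t \<omega> * B s \<omega>) =
        (t powr (2 * H) + s powr (2 * H) - \<bar>t - s\<bar> powr (2 * H)) / 2)"

definition fbm_increment :: "(real \<Rightarrow> 'a \<Rightarrow> real) \<Rightarrow> nat \<Rightarrow> 'a \<Rightarrow> real" where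
  "fbm_increment B n \<omega> = B (real n + 1) \<omega> - B (real n) \<omega>"

text \<open>The sigma-algebra generated by the variables \<open>\<xi> i\<close> with \<open>i \<in> I\<close>.\<close>

definition generated_algebra :: "'a measure \<Rightarrow> (nat \<Rightarrow> 'a \<Rightarrow> real) \<Rightarrow> nat set \<Rightarrow> 'a measure" where
  "generated_algebra M \<xi> I =
     sigma (space M) (\<Union>i\<in>I. sets (vimage_algebra (space M) (\<xi> i) borel))"

text \<open>As with \<^const>\<open>subalgebra\<close>, sigma-algebras are represented by measures of which only the
  space and the measurable sets matter.\<close>

definition noise_filtration ::
    "'a measure \<Rightarrow> 'a measure \<Rightarrow> (nat \<Rightarrow> 'a \<Rightarrow> real) \<Rightarrow> nat \<Rightarrow> 'a measure" where
  "noise_filtration M F0 \<xi> n =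
     sigma (space M) (sets F0 \<union> sets (generated_algebra M \<xi> {..<n}))"

definition Lp_rv :: "'a measure \<Rightarrow> real \<Rightarrow> 'a measure \<Rightarrow> ('a \<Rightarrow> real) set" where
  "Lp_rv M \<beta> G = {Y. Y \<in> borel_measurable G \<and> (\<integral>\<^sup>+\<omega>. ennreal (\<bar>Y \<omega>\<bar> powr \<beta>) \<partial>M) < \<infinity>}"

definition Lp_adapted ::
    "'a measure \<Rightarrow> (nat \<Rightarrow> 'a measure) \<Rightarrow> real \<Rightarrow> nat \<Rightarrow> nat \<Rightarrow> (nat \<Rightarrow> 'a \<Rightarrow> real) set" where
  "Lp_adapted M F \<beta> n1 n2 =
     {X. (\<forall>n\<in>{n1..n2}. X n \<in> borel_measurable (F n)) \<and>
         (\<Sum>n=n1..n2. \<integral>\<^sup>+\<omega>. ennreal (\<bar>X n \<omega>\<bar> powr \<beta>) \<partial>M) < \<infinity>}"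

definition admissible_controls ::
    "'a measure \<Rightarrow> (nat \<Rightarrow> 'a measure) \<Rightarrow> real \<Rightarrow> nat \<Rightarrow> real set \<Rightarrow> (nat \<Rightarrow> 'a \<Rightarrow> real) set" where
  "admissible_controls M F a N U =
     {u. (\<forall>n<N. u n \<in> borel_measurable (F n)) \<and>
         (\<forall>n<N. \<forall>\<omega>\<in>space M. u n \<omega> \<in> U) \<and>
         (\<integral>\<^sup>+\<omega>. ennreal (\<Sum>n<N. \<bar>u n \<omega>\<bar> powr (2 * a)) \<partial>M) < \<infinity>}"

definition partial_x :: "(real \<Rightarrow> real \<Rightarrow> real) \<Rightarrow> real \<Rightarrow> real \<Rightarrow> real" where
  "partial_x f x u = deriv (\<lambda>y. f y u) x"

definition partial_u :: "(real \<Rightarrow> real \<Rightarrow> real) \<Rightarrow> real \<Rightarrow> real \<Rightarrow> real" where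
  "partial_u f x u = deriv (\<lambda>v. f x v) u"

definition differentiable_xu :: "(real \<Rightarrow> real \<Rightarrow> real) \<Rightarrow> bool" where
  "differentiable_xu f \<longleftrightarrow> (\<forall>p. (\<lambda>(x, u). f x u) differentiable (at p))"

definition lipschitz_xu :: "real \<Rightarrow> (real \<Rightarrow> real \<Rightarrow> real) \<Rightarrow> bool" where
  "lipschitz_xu L \<phi> \<longleftrightarrow>
     (\<forall>x1 x2 u1 u2. \<bar>\<phi> x1 u1 - \<phi> x2 u2\<bar> \<le> L * (\<bar>x1 - x2\<bar> + \<bar>u1 - u2\<bar>))"

text \<open>As usual for stochastic equations, the identities are required almost surely.\<close>

definition solves_state_equation ::
    "'a measure \<Rightarrow> nat \<Rightarrow> (nat \<Rightarrow> 'a \<Rightarrow> real \<Rightarrow> real \<Rightarrow> real) \<Rightarrow> (nat \<Rightarrow> 'a \<Rightarrow> real \<Rightarrow> real \<Rightarrow> real) \<Rightarrow>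
     (nat \<Rightarrow> 'a \<Rightarrow> real) \<Rightarrow> (nat \<Rightarrow> 'a \<Rightarrow> real) \<Rightarrow> ('a \<Rightarrow> real) \<Rightarrow> (nat \<Rightarrow> 'a \<Rightarrow> real) \<Rightarrow> bool" where
  "solves_state_equation M N b \<sigma> \<xi> u x X \<longleftrightarrow>
     (AE \<omega> in M. X 0 \<omega> = x \<omega>) \<and>
     (\<forall>n<N. AE \<omega> in M.
        X (Suc n) \<omega> = X n \<omega> + b n \<omega> (X n \<omega>) (u n \<omega>) + \<sigma> n \<omega> (X n \<omega>) (u n \<omega>) * \<xi> n \<omega>)"

end

theory Submission
  imports Defs
begin

text \<open>The equation is an explicit recursion, so the only candidate is the process obtained by
  iterating it from \<open>x\<close> (\<open>state_path\<close>), and by induction every solution agrees with it almost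
  surely (\<open>solves_state_equation_unique\<close>).  What has to be shown is that this process is adapted
  and square integrable.

  Adaptedness needs that a random coefficient evaluated at the random pair \<open>(X n, u n)\<close> is
  measurable at time \<open>n\<close>.  This is not automatic, since the coefficients are assumed measurable in
  \<open>\<omega>\<close> only for fixed arguments; their continuity in the arguments makes it true
  (\<open>borel_measurable_caratheodory\<close>).

  Square integrability is delicate in the term \<open>\<sigma> n (X n) (u n) * \<xi> n\<close>.  In general the
  noise \<open>\<xi>\<close> is correlated, so \<open>\<xi> n\<close> need not be independent of \<open>X n\<close> and the moments of the
  product need not factor.  But \<open>\<xi> n\<close> is Gaussian and has moments of every order
  (\<open>centered_gaussian_Lp_rv\<close>), so by Hoelder's inequality (\<open>Lp_rv_mult\<close>) the product costs an
  arbitrarily small part of the exponent.  The induction in \<open>state_path_adapted_Lp\<close> therefore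
  carries all moments of order strictly below \<open>2 * a\<close>, an open range that is stable under this
  loss.  As \<open>a > 1\<close>, it contains the order 2.\<close>

section \<open>Finite absolute moments\<close>

lemma Lp_rv_dominated:
  assumes Z: "Z \<in> borel_measurable M" and Y: "Y \<in> Lp_rv M p M"
    and le: "\<And>\<omega>. \<omega> \<in> space M \<Longrightarrow> \<bar>Z \<omega>\<bar> \<le> \<bar>Y \<omega>\<bar>" and p: "0 < p"
  shows "Z \<in> Lp_rv M p M"
proof -
  have "(\<integral>\<^sup>+\<omega>. ennreal (\<bar>Z \<omega>\<bar> powr p) \<partial>M) \<le> (\<integral>\<^sup>+\<omega>. ennreal (\<bar>Y \<omega>\<bar> powr p) \<partial>M)"
    using le p by (intro nn_integral_mono ennreal_leI powr_mono2) auto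
  then show ?thesis using Y Z unfolding Lp_rv_def by (auto intro: order.strict_trans1)
qed

text \<open>Sums, products, multiples and changes of exponent are all controlled by a pointwise bound
  of this form.\<close>

lemma Lp_rv_bound_sum:
  assumes Z: "Z \<in> borel_measurable M"
    and X: "X \<in> Lp_rv M q M" and Y: "Y \<in> Lp_rv M r M" and "0 \<le> c"
    and le: "\<And>\<omega>. \<omega> \<in> space M \<Longrightarrow> \<bar>Z \<omega>\<bar> powr p \<le> c * (\<bar>X \<omega>\<bar> powr q + \<bar>Y \<omega>\<bar> powr r)"
  shows "Z \<in> Lp_rv M p M"
proof -
  have [measurable]: "X \<in> borel_measurable M" "Y \<in> borel_measurable M"
    using X Y by (auto simp: Lp_rv_def)
  have "(\<integral>\<^sup>+\<omega>. ennreal (\<bar>Z \<omega>\<bar> powr p) \<partial>M)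
      \<le> (\<integral>\<^sup>+\<omega>. ennreal c * (ennreal (\<bar>X \<omega>\<bar> powr q) + ennreal (\<bar>Y \<omega>\<bar> powr r)) \<partial>M)"
    using le \<open>0 \<le> c\<close>
    by (intro nn_integral_mono) (simp flip: ennreal_plus ennreal_mult'' add: ennreal_leI)
  also have "\<dots> = ennreal c * ((\<integral>\<^sup>+\<omega>. ennreal (\<bar>X \<omega>\<bar> powr q) \<partial>M)
      + (\<integral>\<^sup>+\<omega>. ennreal (\<bar>Y \<omega>\<bar> powr r) \<partial>M))"
    by (simp add: nn_integral_cmult nn_integral_add)
  also have "\<dots> < \<infinity>"
    using X Y by (auto simp: Lp_rv_def ennreal_mult_less_top)
  finally show ?thesis using Z by (simp add: Lp_rv_def)
qed

lemma Lp_rv_add: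
  assumes X: "X \<in> Lp_rv M p M" and Y: "Y \<in> Lp_rv M p M" and p: "0 < p"
  shows "(\<lambda>\<omega>. X \<omega> + Y \<omega>) \<in> Lp_rv M p M"
proof (rule Lp_rv_bound_sum[OF _ X Y, where c = "2 powr p"])
  show "(\<lambda>\<omega>. X \<omega> + Y \<omega>) \<in> borel_measurable M"
    using X Y by (auto simp: Lp_rv_def)
  fix \<omega>
  have "\<bar>X \<omega> + Y \<omega>\<bar> powr p \<le> (2 * max \<bar>X \<omega>\<bar> \<bar>Y \<omega>\<bar>) powr p"
    using p by (intro powr_mono2) auto
  also have "\<dots> = 2 powr p * (max \<bar>X \<omega>\<bar> \<bar>Y \<omega>\<bar> powr p)"
    by (simp add: powr_mult)
  also have "\<dots> \<le> 2 powr p * (\<bar>X \<omega>\<bar> powr p + \<bar>Y \<omega>\<bar> powr p)"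
    by (intro mult_left_mono) (auto simp: max_def)
  finally show "\<bar>X \<omega> + Y \<omega>\<bar> powr p \<le> 2 powr p * (\<bar>X \<omega>\<bar> powr p + \<bar>Y \<omega>\<bar> powr p)" .
qed simp

lemma Lp_rv_cmult:
  assumes X: "X \<in> Lp_rv M p M"
  shows "(\<lambda>\<omega>. c * X \<omega>) \<in> Lp_rv M p M"
proof (rule Lp_rv_bound_sum[OF _ X X, where c = "\<bar>c\<bar> powr p"])
  show "(\<lambda>\<omega>. c * X \<omega>) \<in> borel_measurable M"
    using X by (auto simp: Lp_rv_def)
  show "\<bar>c * X \<omega>\<bar> powr p \<le> \<bar>c\<bar> powr p * (\<bar>X \<omega>\<bar> powr p + \<bar>X \<omega>\<bar> powr p)" for \<omega>
    by (simp add: abs_mult powr_mult mult_left_mono)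
qed simp

lemma powr_le_one_plus_powr:
  fixes x p q :: real
  assumes "0 \<le> x" "0 < p" "p \<le> q"
  shows "x powr p \<le> 1 + x powr q"
proof (cases "x \<le> 1")
  case True
  then have "x powr p \<le> 1 powr p" using assms by (intro powr_mono2) auto
  then show ?thesis by (simp add: add_increasing2)
next
  case False
  then have "x powr p \<le> x powr q" using assms by (intro powr_mono) auto
  then show ?thesis by simp
qed

lemma (in finite_measure) Lp_rv_const: "(\<lambda>\<omega>. c) \<in> Lp_rv M p M"
  by (simp add: Lp_rv_def ennreal_mult_less_top emeasure_eq_measure)

lemma (in finite_measure) Lp_rv_antimono_exponent:
  assumes X: "X \<in> Lp_rv M q M" and "0 < p" "p \<le> q"
  shows "X \<in> Lp_rv M p M"
proof (rule Lp_rv_bound_sum[OF _ Lp_rv_const[of 1 1] X, where c = 1])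
  show "X \<in> borel_measurable M" using X by (simp add: Lp_rv_def)
  show "\<bar>X \<omega>\<bar> powr p \<le> 1 * (\<bar>1\<bar> powr 1 + \<bar>X \<omega>\<bar> powr q)" for \<omega>
    using powr_le_one_plus_powr[of "\<bar>X \<omega>\<bar>" p q] assms by simp
qed simp

text \<open>A crude form of Young's inequality, with the exponents of Hoelder's inequality.  The two
  summands correspond to the two cases in the comparison of \<open>x\<close> with \<open>y powr (p / (q - p))\<close>.\<close>

lemma mult_powr_le_powr_add_powr:
  fixes x y p q :: real
  assumes x: "0 \<le> x" and y: "0 \<le> y" and p: "0 < p" "p < q"
  shows "(x * y) powr p \<le> x powr q + y powr (p * q / (q - p))"
proof (cases "x \<le> y powr (p / (q - p))")
  case True
  have e: "p / (q - p) * p + p = p * q / (q - p)"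
    using p by (simp add: field_simps)
  have "(x * y) powr p = x powr p * y powr p"
    using x y by (simp add: powr_mult)
  also have "\<dots> \<le> (y powr (p / (q - p))) powr p * y powr p"
    using True x p by (intro mult_right_mono powr_mono2) auto
  also have "\<dots> = y powr (p * q / (q - p))"
    by (simp only: powr_powr e flip: powr_add)
  finally show ?thesis by (simp add: add_increasing)
next
  case False
  then have less: "y powr (p / (q - p)) \<le> x" by simp
  have "(y powr (p / (q - p))) powr (q - p) \<le> x powr (q - p)"
    using less p by (intro powr_mono2) auto
  then have *: "y powr p \<le> x powr (q - p)"
    using p by (simp add: powr_powr)
  have "(x * y) powr p = x powr p * y powr p"
    using x y by (simp add: powr_mult)
  also have "\<dots> \<le> x powr p * x powr (q - p)"
    using * by (intro mult_left_mono) auto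
  also have "\<dots> = x powr q"
    by (simp flip: powr_add)
  finally show ?thesis by (simp add: add_increasing2)
qed

lemma Lp_rv_mult:
  assumes X: "X \<in> Lp_rv M q M" and Y: "Y \<in> Lp_rv M (p * q / (q - p)) M"
    and p: "0 < p" "p < q"
  shows "(\<lambda>\<omega>. X \<omega> * Y \<omega>) \<in> Lp_rv M p M"
proof (rule Lp_rv_bound_sum[OF _ X Y, where c = 1])
  show "(\<lambda>\<omega>. X \<omega> * Y \<omega>) \<in> borel_measurable M"
    using X Y by (auto simp: Lp_rv_def)
  show "\<bar>X \<omega> * Y \<omega>\<bar> powr p \<le> 1 * (\<bar>X \<omega>\<bar> powr q + \<bar>Y \<omega>\<bar> powr (p * q / (q - p)))" for \<omega>
    using mult_powr_le_powr_add_powr[of "\<bar>X \<omega>\<bar>" "\<bar>Y \<omega>\<bar>" p q] p by (simp add: abs_mult)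
qed simp

section \<open>Gaussian noise\<close>

lemma (in prob_space) centered_gaussian_Lp_rv:
  assumes Y: "centered_gaussian M Y" and p: "0 < p"
  shows "Y \<in> Lp_rv M p M"
proof -
  have [measurable]: "Y \<in> borel_measurable M"
    using Y by (simp add: centered_gaussian_def)
  from Y consider "AE \<omega> in M. Y \<omega> = 0" | s where "s > 0" "distributed M lborel Y (normal_density 0 s)"
    by (auto simp: centered_gaussian_def)
  then show ?thesis
  proof cases
    case 1
    then have "(\<integral>\<^sup>+\<omega>. ennreal (\<bar>Y \<omega>\<bar> powr p) \<partial>M) = (\<integral>\<^sup>+\<omega>. 0 \<partial>M)"
      by (intro nn_integral_cong_AE) auto
    then show ?thesis by (simp add: Lp_rv_def)
  next
    case 2
    \<comment> \<open>Integrability of natural powers under the normal density is known, and one of them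
      dominates the given real power.\<close>
    obtain k where k: "p \<le> real k" using real_arch_simple by blast
    have "integrable lborel (\<lambda>y. normal_density 0 s y * \<bar>y - 0\<bar> ^ k)"
      using 2(1) by (rule integrable_normal_moment_abs)
    then have "integrable M (\<lambda>\<omega>. \<bar>Y \<omega>\<bar> ^ k)"
      using distributed_integrable[OF 2(2), of "\<lambda>y. \<bar>y\<bar> ^ k"] by simp
    then have "(\<integral>\<^sup>+\<omega>. ennreal (\<bar>Y \<omega>\<bar> ^ k) \<partial>M) < \<infinity>"
      by (simp add: integrable_iff_bounded)
    moreover have "\<bar>Y \<omega>\<bar> ^ k = \<bar>Y \<omega>\<bar> powr real k" for \<omega>
      using k p by (subst powr_realpow') auto
    ultimately have "Y \<in> Lp_rv M (real k) M" by (simp add: Lp_rv_def)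
    then show ?thesis using p k by (rule Lp_rv_antimono_exponent)
  qed
qed

lemma centered_gaussian_fbm_increment:
  assumes "fractional_brownian_motion M H B"
  shows "centered_gaussian M (fbm_increment B n)"
proof -
  define c :: "real \<Rightarrow> real" where "c t = (if t = real n then - 1 else 1)" for t
  have "centered_gaussian_process M B"
    using assms by (simp add: fractional_brownian_motion_def)
  then have "centered_gaussian M (\<lambda>\<omega>. \<Sum>t\<in>{real n, real n + 1}. c t * B t \<omega>)"
    unfolding centered_gaussian_process_def
    by (rule allE[where x = "{real n, real n + 1}"]) (simp del: sum.insert)
  moreover have "(\<lambda>\<omega>. \<Sum>t\<in>{real n, real n + 1}. c t * B t \<omega>) = fbm_increment B n"
    by (auto simp: c_def fbm_increment_def)
  ultimately show ?thesis by simp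
qed

section \<open>The noise filtration\<close>

lemma noise_filtration_generators:
  "sets F0 \<union> sets (generated_algebra M \<xi> I) \<subseteq> Pow (space M)" if "subalgebra M F0"
  using that sets.sets_into_space[of _ F0] sets.sets_into_space[of _ "generated_algebra M \<xi> I"]
  by (auto simp: subalgebra_def generated_algebra_def space_measure_of_conv)

lemma space_noise_filtration [simp]: "space (noise_filtration M F0 \<xi> n) = space M"
  by (simp add: noise_filtration_def space_measure_of_conv)

lemma sets_noise_filtration:
  assumes "subalgebra M F0"
  shows "sets (noise_filtration M F0 \<xi> n) =
    sigma_sets (space M) (sets F0 \<union> sets (generated_algebra M \<xi> {..<n}))"
  unfolding noise_filtration_def
  using noise_filtration_generators[OF assms] by (rule sets_measure_of)

lemma sets_generated_algebra:
  "sets (generated_algebra M \<xi> I) =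
    sigma_sets (space M) (\<Union>i\<in>I. sets (vimage_algebra (space M) (\<xi> i) borel))"
  unfolding generated_algebra_def
proof (rule sets_measure_of)
  show "(\<Union>i\<in>I. sets (vimage_algebra (space M) (\<xi> i) borel)) \<subseteq> Pow (space M)"
    using sets.sets_into_space by fastforce
qed

lemma subalgebra_noise_filtration:
  assumes F0: "subalgebra M F0" and \<xi>: "\<And>i. \<xi> i \<in> borel_measurable M"
  shows "subalgebra M (noise_filtration M F0 \<xi> n)"
proof -
  have "sets (vimage_algebra (space M) (\<xi> i) borel) \<subseteq> sets M" for i
    using \<xi>[of i] by (auto simp: sets_vimage_algebra2 measurable_sets)
  then have "sets (generated_algebra M \<xi> {..<n}) \<subseteq> sets M"
    unfolding sets_generated_algebra by (intro sets.sigma_sets_subset) auto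
  then show ?thesis
    using F0 unfolding subalgebra_def sets_noise_filtration[OF F0]
    by (auto intro!: sets.sigma_sets_subset)
qed

lemma noise_filtration_mono:
  assumes F0: "subalgebra M F0" and "m \<le> n"
  shows "subalgebra (noise_filtration M F0 \<xi> n) (noise_filtration M F0 \<xi> m)"
proof -
  have "sets (generated_algebra M \<xi> {..<m}) \<subseteq> sets (generated_algebra M \<xi> {..<n})"
    unfolding sets_generated_algebra using \<open>m \<le> n\<close> by (intro sigma_sets_mono' UN_mono) auto
  then show ?thesis
    unfolding subalgebra_def sets_noise_filtration[OF F0] by (auto intro!: sigma_sets_mono')
qed

lemma noise_filtration_initial:
  assumes F0: "subalgebra M F0"
  shows "subalgebra (noise_filtration M F0 \<xi> n) F0"
  using F0 by (auto simp: subalgebra_def sets_noise_filtration[OF F0])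

lemma noise_measurable:
  assumes F0: "subalgebra M F0" and "i < n"
  shows "\<xi> i \<in> borel_measurable (noise_filtration M F0 \<xi> n)"
proof (rule measurableI)
  fix A :: "real set" assume A: "A \<in> sets borel"
  have "\<xi> i -` A \<inter> space M \<in> sets (vimage_algebra (space M) (\<xi> i) borel)"
    using A by (rule in_vimage_algebra)
  then show "\<xi> i -` A \<inter> space (noise_filtration M F0 \<xi> n) \<in> sets (noise_filtration M F0 \<xi> n)"
    using \<open>i < n\<close> by (auto simp: sets_noise_filtration[OF F0] sets_generated_algebra)
qed simp

section \<open>Random coefficients\<close>

text \<open>A function that is measurable in \<open>\<omega>\<close> and continuous in the other arguments (a
  Caratheodory function) may be evaluated at random arguments: rounding the arguments down to
  multiples of \<open>1 / k\<close> leaves countably many values, and continuity carries measurability to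
  the limit.\<close>

lemma borel_measurable_caratheodory:
  fixes f :: "'a \<Rightarrow> real \<Rightarrow> real \<Rightarrow> real"
  assumes f: "\<And>y v. (\<lambda>\<omega>. f \<omega> y v) \<in> borel_measurable G"
    and cont: "\<And>\<omega>. \<omega> \<in> space G \<Longrightarrow> continuous_on UNIV (\<lambda>(y, v). f \<omega> y v)"
    and Y [measurable]: "Y \<in> borel_measurable G" and V [measurable]: "V \<in> borel_measurable G"
  shows "(\<lambda>\<omega>. f \<omega> (Y \<omega>) (V \<omega>)) \<in> borel_measurable G"
proof (rule borel_measurable_LIMSEQ_real)
  define r :: "nat \<Rightarrow> int \<Rightarrow> real" where "r k m = of_int m / real (Suc k)" for k m
  show "(\<lambda>\<omega>. f \<omega> (r k \<lfloor>real (Suc k) * Y \<omega>\<rfloor>) (r k \<lfloor>real (Suc k) * V \<omega>\<rfloor>)) \<in> borel_measurable G"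
    for k
  proof -
    have "(\<lambda>\<omega>. (\<lambda>(i, j) \<omega>. f \<omega> (r k i) (r k j))
        (\<lfloor>real (Suc k) * Y \<omega>\<rfloor>, \<lfloor>real (Suc k) * V \<omega>\<rfloor>) \<omega>) \<in> borel_measurable G"
      by (rule measurable_compose_countable) (auto intro: f simp del: of_nat_Suc)
    then show ?thesis by simp
  qed
  have round: "(\<lambda>k. r k \<lfloor>real (Suc k) * z\<rfloor>) \<longlonglongrightarrow> z" for z
  proof (rule tendsto_sandwich)
    show "\<forall>\<^sub>F k in sequentially. z - 1 / real (Suc k) \<le> r k \<lfloor>real (Suc k) * z\<rfloor>"
    proof (intro always_eventually allI)
      fix k
      have "z - 1 / real (Suc k) = (real (Suc k) * z - 1) / real (Suc k)"
        by (simp add: field_simps)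
      also have "\<dots> \<le> r k \<lfloor>real (Suc k) * z\<rfloor>"
        unfolding r_def by (intro divide_right_mono) linarith+
      finally show "z - 1 / real (Suc k) \<le> r k \<lfloor>real (Suc k) * z\<rfloor>" .
    qed
    show "\<forall>\<^sub>F k in sequentially. r k \<lfloor>real (Suc k) * z\<rfloor> \<le> z"
    proof (intro always_eventually allI)
      fix k
      have "r k \<lfloor>real (Suc k) * z\<rfloor> \<le> (real (Suc k) * z) / real (Suc k)"
        unfolding r_def by (intro divide_right_mono) linarith+
      then show "r k \<lfloor>real (Suc k) * z\<rfloor> \<le> z" by simp
    qed
    show "(\<lambda>k. z - 1 / real (Suc k)) \<longlonglongrightarrow> z"
      using tendsto_diff[OF tendsto_const LIMSEQ_inverse_real_of_nat, of z]
      by (simp add: inverse_eq_divide)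
  qed simp
  fix \<omega> assume "\<omega> \<in> space G"
  then have "isCont (\<lambda>(y, v). f \<omega> y v) (Y \<omega>, V \<omega>)"
    using cont by (simp add: continuous_on_eq_continuous_at)
  from isCont_tendsto_compose[OF this tendsto_Pair[OF round round]]
  show "(\<lambda>k. f \<omega> (r k \<lfloor>real (Suc k) * Y \<omega>\<rfloor>) (r k \<lfloor>real (Suc k) * V \<omega>\<rfloor>))
      \<longlonglongrightarrow> f \<omega> (Y \<omega>) (V \<omega>)"
    by simp
qed

lemma lipschitz_xu_continuous:
  assumes "lipschitz_xu L f"
  shows "continuous_on UNIV (\<lambda>(y, v). f y v)"
proof -
  have "isCont (\<lambda>(y, v). f y v) (y0, v0)" for y0 v0
  proof -
    let ?g = "\<lambda>p. L * (\<bar>fst p - y0\<bar> + \<bar>snd p - v0\<bar>)"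
    have "isCont ?g (y0, v0)" by (intro continuous_intros)
    then have "(?g \<longlongrightarrow> 0) (at (y0, v0))" by (simp add: isCont_def)
    moreover have "\<forall>\<^sub>F p in at (y0, v0). norm ((\<lambda>(y, v). f y v) p - f y0 v0) \<le> ?g p"
      using assms by (intro always_eventually) (simp add: lipschitz_xu_def split: prod.split)
    ultimately have "((\<lambda>p. (\<lambda>(y, v). f y v) p - f y0 v0) \<longlongrightarrow> 0) (at (y0, v0))"
      by (rule Lim_null_comparison[rotated])
    then show ?thesis by (simp add: isCont_def LIM_zero_iff)
  qed
  then show ?thesis by (auto simp: continuous_on_eq_continuous_at)
qed

text \<open>The Lipschitz condition gives linear growth around \<open>(0, 0)\<close>, so the moments of the arguments
  and of the value at the origin carry over.\<close>

lemma lipschitz_coefficient_Lp_rv: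
  assumes lip: "\<And>\<omega>. \<omega> \<in> space M \<Longrightarrow> lipschitz_xu L (f \<omega>)"
    and f: "(\<lambda>\<omega>. f \<omega> (Y \<omega>) (V \<omega>)) \<in> borel_measurable M"
    and f0: "(\<lambda>\<omega>. f \<omega> 0 0) \<in> Lp_rv M p M"
    and Y: "Y \<in> Lp_rv M p M" and V: "V \<in> Lp_rv M p M" and p: "0 < p"
  shows "(\<lambda>\<omega>. f \<omega> (Y \<omega>) (V \<omega>)) \<in> Lp_rv M p M"
proof -
  have abs: "(\<lambda>\<omega>. \<bar>Z \<omega>\<bar>) \<in> Lp_rv M p M" if "Z \<in> Lp_rv M p M" for Z
    using that by (auto simp: Lp_rv_def)
  have "(\<lambda>\<omega>. \<bar>f \<omega> 0 0\<bar> + L * (\<bar>Y \<omega>\<bar> + \<bar>V \<omega>\<bar>)) \<in> Lp_rv M p M"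
    by (intro Lp_rv_add Lp_rv_cmult abs f0 Y V p)
  then show ?thesis
  proof (rule Lp_rv_dominated[OF f _ _ p])
    fix \<omega> assume "\<omega> \<in> space M"
    then have "\<bar>f \<omega> (Y \<omega>) (V \<omega>) - f \<omega> 0 0\<bar> \<le> L * (\<bar>Y \<omega> - 0\<bar> + \<bar>V \<omega> - 0\<bar>)"
      using lip unfolding lipschitz_xu_def by blast
    then show "\<bar>f \<omega> (Y \<omega>) (V \<omega>)\<bar> \<le> \<bar>\<bar>f \<omega> 0 0\<bar> + L * (\<bar>Y \<omega>\<bar> + \<bar>V \<omega>\<bar>)\<bar>"
      by simp
  qed
qed

section \<open>The state equation\<close>

primrec state_path ::
    "(nat \<Rightarrow> 'a \<Rightarrow> real \<Rightarrow> real \<Rightarrow> real) \<Rightarrow> (nat \<Rightarrow> 'a \<Rightarrow> real \<Rightarrow> real \<Rightarrow> real) \<Rightarrow>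
     (nat \<Rightarrow> 'a \<Rightarrow> real) \<Rightarrow> (nat \<Rightarrow> 'a \<Rightarrow> real) \<Rightarrow> ('a \<Rightarrow> real) \<Rightarrow> nat \<Rightarrow> 'a \<Rightarrow> real" where
  "state_path b \<sigma> \<xi> u x 0 = x"
| "state_path b \<sigma> \<xi> u x (Suc n) = (\<lambda>\<omega>. let y = state_path b \<sigma> \<xi> u x n \<omega> in
     y + b n \<omega> y (u n \<omega>) + \<sigma> n \<omega> y (u n \<omega>) * \<xi> n \<omega>)"

lemma solves_state_equation_state_path:
  "solves_state_equation M N b \<sigma> \<xi> u x (state_path b \<sigma> \<xi> u x)"
  by (simp add: solves_state_equation_def Let_def)

lemma solves_state_equation_unique:
  assumes Y: "solves_state_equation M N b \<sigma> \<xi> u x Y"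
  shows "AE \<omega> in M. \<forall>n\<le>N. Y n \<omega> = state_path b \<sigma> \<xi> u x n \<omega>"
proof -
  have "AE \<omega> in M. Y 0 \<omega> = x \<omega>"
    using Y by (simp add: solves_state_equation_def)
  moreover have "AE \<omega> in M. \<forall>n\<in>{..<N}.
      Y (Suc n) \<omega> = Y n \<omega> + b n \<omega> (Y n \<omega>) (u n \<omega>) + \<sigma> n \<omega> (Y n \<omega>) (u n \<omega>) * \<xi> n \<omega>"
    using Y by (intro AE_finite_allI) (auto simp: solves_state_equation_def)
  ultimately show ?thesis
  proof eventually_elim
    case (elim \<omega>)
    have "n \<le> N \<Longrightarrow> Y n \<omega> = state_path b \<sigma> \<xi> u x n \<omega>" for n
      using elim by (induction n) (auto simp: Let_def)
    then show ?case by blast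
  qed
qed

text \<open>Moments of every order below \<open>q\<close> pass from each time to the next, although the order \<open>q\<close>
  itself need not: an intermediate exponent \<open>r\<close> with \<open>p < r < q\<close> leaves room for the factor
  \<open>\<xi> n\<close>, which has all moments but may depend on the state.\<close>

lemma (in prob_space) state_path_adapted_Lp:
  fixes F :: "nat \<Rightarrow> 'a measure"
  assumes sub: "\<And>n. subalgebra M (F n)" and mono: "\<And>m n. m \<le> n \<Longrightarrow> subalgebra (F n) (F m)"
    and \<xi>F: "\<And>n. \<xi> n \<in> borel_measurable (F (Suc n))"
    and \<xi>: "\<And>n p. 0 < p \<Longrightarrow> \<xi> n \<in> Lp_rv M p M"
    and xF: "x \<in> borel_measurable (F 0)" and x: "x \<in> Lp_rv M q M"
    and uF: "\<And>n. n < N \<Longrightarrow> u n \<in> borel_measurable (F n)"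
    and u: "\<And>n. n < N \<Longrightarrow> u n \<in> Lp_rv M q M"
    and coeffF: "\<And>n y v f. \<lbrakk>n < N; f \<in> {b, \<sigma>}\<rbrakk> \<Longrightarrow> (\<lambda>\<omega>. f n \<omega> y v) \<in> borel_measurable (F n)"
    and coeff: "\<And>n f. \<lbrakk>n < N; f \<in> {b, \<sigma>}\<rbrakk> \<Longrightarrow> (\<lambda>\<omega>. f n \<omega> 0 0) \<in> Lp_rv M q M"
    and lip: "\<And>n f \<omega>. \<lbrakk>n < N; f \<in> {b, \<sigma>}; \<omega> \<in> space M\<rbrakk> \<Longrightarrow> lipschitz_xu L (f n \<omega>)"
    and "n \<le> N"
  shows "state_path b \<sigma> \<xi> u x n \<in> borel_measurable (F n) \<and>
    (\<forall>p. 0 < p \<and> p < q \<longrightarrow> state_path b \<sigma> \<xi> u x n \<in> Lp_rv M p M)"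
  using \<open>n \<le> N\<close>
proof (induction n)
  case 0
  show ?case using xF x by (auto intro: Lp_rv_antimono_exponent)
next
  case (Suc n)
  let ?X = "state_path b \<sigma> \<xi> u x n"
  have n: "n < N" and XF: "?X \<in> borel_measurable (F n)"
    and X: "\<And>p. 0 < p \<Longrightarrow> p < q \<Longrightarrow> ?X \<in> Lp_rv M p M"
    using Suc by auto
  have space: "space (F n) = space M" using sub by (simp add: subalgebra_def)
  have fF: "(\<lambda>\<omega>. f n \<omega> (?X \<omega>) (u n \<omega>)) \<in> borel_measurable (F n)" if "f \<in> {b, \<sigma>}" for f
  proof (rule borel_measurable_caratheodory[OF _ _ XF uF[OF n]])
    show "(\<lambda>\<omega>. f n \<omega> y v) \<in> borel_measurable (F n)" for y v
      using n that by (rule coeffF)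
    show "continuous_on UNIV (\<lambda>(y, v). f n \<omega> y v)" if "\<omega> \<in> space (F n)" for \<omega>
      using lip[OF n \<open>f \<in> {b, \<sigma>}\<close>] that unfolding space by (intro lipschitz_xu_continuous)
  qed
  have f: "(\<lambda>\<omega>. f n \<omega> (?X \<omega>) (u n \<omega>)) \<in> Lp_rv M p M"
    if "f \<in> {b, \<sigma>}" "0 < p" "p < q" for f p
  proof (rule lipschitz_coefficient_Lp_rv[where f = "f n"])
    show "(\<lambda>\<omega>. f n \<omega> (?X \<omega>) (u n \<omega>)) \<in> borel_measurable M"
      using measurable_from_subalg[OF sub fF[OF that(1)]] .
    show "lipschitz_xu L (f n \<omega>)" if "\<omega> \<in> space M" for \<omega>
      using n \<open>f \<in> {b, \<sigma>}\<close> that by (rule lip)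
    show "(\<lambda>\<omega>. f n \<omega> 0 0) \<in> Lp_rv M p M"
      using coeff[OF n that(1)] that(2) less_imp_le[OF that(3)] by (rule Lp_rv_antimono_exponent)
    show "u n \<in> Lp_rv M p M"
      using u[OF n] that(2) less_imp_le[OF that(3)] by (rule Lp_rv_antimono_exponent)
    show "?X \<in> Lp_rv M p M" "0 < p"
      using that X by blast+
  qed
  have step: "Z \<in> borel_measurable (F (Suc n))" if "Z \<in> borel_measurable (F n)" for Z :: "'a \<Rightarrow> real"
    using measurable_from_subalg[OF mono that] by simp
  have "state_path b \<sigma> \<xi> u x (Suc n) \<in> borel_measurable (F (Suc n))"
    using step[OF XF] step[OF fF[of b]] step[OF fF[of \<sigma>]] \<xi>F[of n] by (simp add: Let_def)
  moreover have "state_path b \<sigma> \<xi> u x (Suc n) \<in> Lp_rv M p M" if p: "0 < p" "p < q" for p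
  proof -
    obtain r where r: "p < r" "r < q" using dense p by blast
    have "(\<lambda>\<omega>. \<sigma> n \<omega> (?X \<omega>) (u n \<omega>) * \<xi> n \<omega>) \<in> Lp_rv M p M"
      using p r by (intro Lp_rv_mult[where q = r] f \<xi>) auto
    then show ?thesis
      using X[OF p] f[of b p] p by (auto simp: Let_def intro!: Lp_rv_add)
  qed
  ultimately show ?case by blast
qed

theorem lemma2:
  fixes M F0 :: "'a measure"
    and H a L :: real and N :: nat
    and B :: "real \<Rightarrow> 'a \<Rightarrow> real"
    and \<xi> :: "nat \<Rightarrow> 'a \<Rightarrow> real"
    and F :: "nat \<Rightarrow> 'a measure"
    and x :: "'a \<Rightarrow> real"
    and b \<sigma> :: "nat \<Rightarrow> 'a \<Rightarrow> real \<Rightarrow> real \<Rightarrow> real"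
    and l :: "nat \<Rightarrow> real \<Rightarrow> real \<Rightarrow> real"
    and \<Phi> :: "real \<Rightarrow> real"
    and U :: "real set"
    and u :: "nat \<Rightarrow> 'a \<Rightarrow> real"
  defines "\<xi> \<equiv> fbm_increment B"
    and "F \<equiv> noise_filtration M F0 \<xi>"
  assumes "prob_space M"
    and "0 < H" "H < 1" "1 < a" "1 \<le> N"
    and "fractional_brownian_motion M H B"
    and "subalgebra M F0"
    and "x \<in> Lp_rv M (2 * a) F0"
    and "prob_space.indep_set M
           (sets (vimage_algebra (space M) x borel)) (sets (generated_algebra M \<xi> UNIV))"
    and "closed U" "convex U"
    and meas_b: "\<forall>\<omega>\<in>space M. (\<lambda>(n, y, v). b n \<omega> y v)
           \<in> borel_measurable (count_space {..<N} \<Otimes>\<^sub>M borel \<Otimes>\<^sub>M borel)"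
    and meas_\<sigma>: "\<forall>\<omega>\<in>space M. (\<lambda>(n, y, v). \<sigma> n \<omega> y v)
           \<in> borel_measurable (count_space {..<N} \<Otimes>\<^sub>M borel \<Otimes>\<^sub>M borel)"
    and meas_l: "(\<lambda>(n, y, v). l n y v)
           \<in> borel_measurable (count_space {..<N} \<Otimes>\<^sub>M borel \<Otimes>\<^sub>M borel)"
    and meas_\<Phi>: "\<Phi> \<in> borel_measurable borel"
    and i: "\<forall>y v. (\<lambda>n \<omega>. b n \<omega> y v) \<in> Lp_adapted M F (2 * a) 0 (N - 1)"
           "\<forall>y v. (\<lambda>n \<omega>. \<sigma> n \<omega> y v) \<in> Lp_adapted M F (2 * a) 0 (N - 1)"
    and "0 < L"
    and ii: "\<forall>n<N. \<forall>\<omega>\<in>space M. differentiable_xu (b n \<omega>) \<and> differentiable_xu (\<sigma> n \<omega>)"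
            "\<forall>n<N. \<forall>\<omega>\<in>space M.
               \<forall>\<phi>\<in>{b n \<omega>, \<sigma> n \<omega>, partial_x (b n \<omega>), partial_x (\<sigma> n \<omega>),
                    partial_u (b n \<omega>), partial_u (\<sigma> n \<omega>)}. lipschitz_xu L \<phi>"
    and iii: "\<forall>n<N. differentiable_xu (l n)" "\<forall>y. \<Phi> differentiable (at y)"
             "\<forall>n<N. \<forall>y v. \<bar>partial_x (l n) y v\<bar> + \<bar>deriv \<Phi> y\<bar> \<le> L * (1 + \<bar>y\<bar> + \<bar>v\<bar>)"
    and iv: "\<forall>\<omega>\<in>space M. \<forall>y v. b N \<omega> y v = 0 \<and> \<sigma> N \<omega> y v = 0" "\<forall>y v. l N y v = 0"
    and "u \<in> admissible_controls M F a N U"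
  shows "\<exists>X. X \<in> Lp_adapted M F 2 0 N \<and> solves_state_equation M N b \<sigma> \<xi> u x X \<and>
           (\<forall>Y. Y \<in> Lp_adapted M F 2 0 N \<and> solves_state_equation M N b \<sigma> \<xi> u x Y \<longrightarrow>
              (AE \<omega> in M. \<forall>n\<le>N. Y n \<omega> = X n \<omega>))"
proof -
  interpret prob_space M by fact
  have gauss: "centered_gaussian M (\<xi> n)" for n
    unfolding \<xi>_def using \<open>fractional_brownian_motion M H B\<close>
    by (rule centered_gaussian_fbm_increment)
  have \<xi>M: "\<xi> n \<in> borel_measurable M" for n
    using gauss by (simp add: centered_gaussian_def)
  have F0: "subalgebra M F0" by fact
  have sub: "subalgebra M (F n)" for n
    unfolding F_def using F0 \<xi>M by (rule subalgebra_noise_filtration)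
  have toM: "Z \<in> borel_measurable M" if "Z \<in> borel_measurable (F n)" for Z :: "'a \<Rightarrow> real" and n
    using measurable_from_subalg[OF sub that] .
  have xF: "x \<in> borel_measurable (F 0)"
    unfolding F_def using \<open>x \<in> Lp_rv M (2 * a) F0\<close>
    by (intro measurable_from_subalg[OF noise_filtration_initial[OF F0]]) (simp add: Lp_rv_def)
  have x: "x \<in> Lp_rv M (2 * a) M"
    using \<open>x \<in> Lp_rv M (2 * a) F0\<close> toM[OF xF] by (simp add: Lp_rv_def)
  have uF: "u n \<in> borel_measurable (F n)" if "n < N" for n
    using \<open>u \<in> admissible_controls M F a N U\<close> that by (simp add: admissible_controls_def)
  have u: "u n \<in> Lp_rv M (2 * a) M" if "n < N" for n
  proof -
    have "(\<integral>\<^sup>+\<omega>. ennreal (\<bar>u n \<omega>\<bar> powr (2 * a)) \<partial>M)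
        \<le> (\<integral>\<^sup>+\<omega>. ennreal (\<Sum>k<N. \<bar>u k \<omega>\<bar> powr (2 * a)) \<partial>M)"
      using that by (intro nn_integral_mono ennreal_leI member_le_sum) auto
    also have "\<dots> < \<infinity>"
      using \<open>u \<in> admissible_controls M F a N U\<close> by (simp add: admissible_controls_def)
    finally show ?thesis using toM[OF uF[OF that]] by (simp add: Lp_rv_def)
  qed
  have adapted: "Z n \<in> borel_measurable (F n) \<and> Z n \<in> Lp_rv M (2 * a) M"
    if Z: "Z \<in> Lp_adapted M F (2 * a) 0 (N - 1)" and n: "n < N" for Z n
  proof -
    have n': "n \<in> {0..N - 1}" using n by auto
    then have ZF: "Z n \<in> borel_measurable (F n)" using Z by (auto simp: Lp_adapted_def)
    moreover have "(\<integral>\<^sup>+\<omega>. ennreal (\<bar>Z n \<omega>\<bar> powr (2 * a)) \<partial>M) < \<infinity>"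
      using Z n' by (auto simp: Lp_adapted_def)
    ultimately show ?thesis using toM[OF ZF] by (simp add: Lp_rv_def)
  qed
  have coeff: "(\<lambda>\<omega>. f n \<omega> y v) \<in> borel_measurable (F n) \<and> (\<lambda>\<omega>. f n \<omega> y v) \<in> Lp_rv M (2 * a) M"
    if "n < N" "f \<in> {b, \<sigma>}" for f n y v
    using that i adapted[of "\<lambda>n \<omega>. f n \<omega> y v" n] by auto
  let ?X = "state_path b \<sigma> \<xi> u x"
  have X: "?X n \<in> borel_measurable (F n) \<and>
      (\<forall>p. 0 < p \<and> p < 2 * a \<longrightarrow> ?X n \<in> Lp_rv M p M)" if "n \<le> N" for n
  proof (rule state_path_adapted_Lp[where N = N and L = L])
    show "subalgebra (F n) (F m)" if "m \<le> n" for m n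
      unfolding F_def using F0 that by (rule noise_filtration_mono)
    show "\<xi> n \<in> borel_measurable (F (Suc n))" for n
      unfolding F_def using F0 by (rule noise_measurable) simp
    show "\<xi> n \<in> Lp_rv M p M" if "0 < p" for n p
      using gauss that by (rule centered_gaussian_Lp_rv)
    show "lipschitz_xu L (f n \<omega>)" if "n < N" "f \<in> {b, \<sigma>}" "\<omega> \<in> space M" for n f \<omega>
      using ii(2) that by auto
  qed (use sub xF x uF u coeff that in auto)
  \<comment> \<open>Since \<open>1 < a\<close>, the exponent 2 is among the exponents below \<open>2 * a\<close>.\<close>
  have "?X n \<in> Lp_rv M 2 M" if "n \<le> N" for n
    using X[OF that] \<open>1 < a\<close> by auto
  then have "?X \<in> Lp_adapted M F 2 0 N"
    using X by (auto simp: Lp_adapted_def Lp_rv_def)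
  then show ?thesis
    using solves_state_equation_state_path solves_state_equation_unique by blast
qed

end
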